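(* Let $T$ be a tree with $\kappa_{\mathrm m}(T)=2$, and suppose that $H=R\cup U$ (disjoint union) is a disconnected graph generalized cospectral with $T$, where $R$ is a tree and $U$ is a connected bipartite unicyclic graph. Then the unique cycle $C=C_{2\ell}$ of $U$ has length at least $6$. Equivalently, $\ell\ge3$.
   Context: All graphs are finite, simple and undirected. For a graph $X$, $A(X)$ is its adjacency matrix and $\phi_X(x)=\det(xI-A(X))$. Two graphs are generalized cospectral if they have the same adjacency spectrum and their complements have the same adjacency spectrum. An adjacency eigenvalue is main if its eigenspace is not orthogonal to the all-one vector; the main polynomial $M_X(x)$ is the product of $(x-\lambda)$ over the distinct main eigenvalues $\lambda$ of $X$ (it divides $\phi_X$ in $\mathbb Z[x]$). If $\phi_X=\prod_{i=1}^r f_i^{m_i}$ with $f_i$ distinct, monic and irreducible over $\mathbb Q$, the main-factor multiplicity is $\kappa_{\mathrm m}(X):=\sum_{i:\,f_i\mid M_X} m_i$. A connected graph is unicyclic if it contains exactly one cycle. *)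

theory Defs
  imports
    "HOL-Computational_Algebra.Field_as_Ring"
    "Graph_Theory.Digraph_Component"
    "Graph_Theory.Pair_Digraph"
    "Jordan_Normal_Form.Char_Poly"
begin

text \<open>
  A finite, simple, undirected graph is a \<open>pair_graph\<close>: a finite, loop-free digraph with
  symmetric arc relation and without parallel arcs; an edge \<open>{u, v}\<close> is the pair of arcs
  \<open>(u, v)\<close>, \<open>(v, u)\<close>.
\<close>

definition graph_complement :: "'a pair_pre_digraph \<Rightarrow> 'a pair_pre_digraph" where
  "graph_complement G =
    \<lparr> pverts = pverts G,
      parcs = {(u, v). u \<in> pverts G \<and> v \<in> pverts G \<and> u \<noteq> v \<and> (u, v) \<notin> parcs G} \<rparr>"

definition disjoint_union ::
  "'a pair_pre_digraph \<Rightarrow> 'a pair_pre_digraph \<Rightarrow> 'a pair_pre_digraph \<Rightarrow> bool" where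
  "disjoint_union H R U \<longleftrightarrow>
    pverts R \<inter> pverts U = {} \<and>
    H = \<lparr> pverts = pverts R \<union> pverts U, parcs = parcs R \<union> parcs U \<rparr>"

definition bipartite :: "'a pair_pre_digraph \<Rightarrow> bool" where
  "bipartite G \<longleftrightarrow>
    (\<exists>A B. A \<union> B = pverts G \<and> A \<inter> B = {} \<and> parcs G \<subseteq> A \<times> B \<union> B \<times> A)"

text \<open>
  A cycle of the undirected graph is represented by its edge set, so that the closed walks
  obtained by rotation and reversal give the same cycle, and its length is the cardinality of
  that set. The bound on \<open>length p\<close> is needed because \<open>(u, v)\<close>, \<open>(v, u)\<close> is a
  cycle of the symmetric digraph. For the same reason \<open>forest\<close> and \<open>tree\<close> of
  \<open>Digraph_Component\<close> do not describe undirected forests and trees.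
\<close>

definition graph_cycles :: "'a pair_pre_digraph \<Rightarrow> 'a set set set" where
  "graph_cycles G =
    {(\<lambda>(u, v). {u, v}) ` set p | p. pre_digraph.cycle (with_proj G) p \<and> 3 \<le> length p}"

definition is_tree :: "'a pair_pre_digraph \<Rightarrow> bool" where
  "is_tree G \<longleftrightarrow> pair_graph G \<and> Digraph_Component.connected (with_proj G) \<and> graph_cycles G = {}"

definition unicyclic :: "'a pair_pre_digraph \<Rightarrow> bool" where
  "unicyclic G \<longleftrightarrow> pair_graph G \<and> Digraph_Component.connected (with_proj G) \<and> (\<exists>!C. C \<in> graph_cycles G)"

text \<open>
  The adjacency matrix refers to an arbitrary fixed enumeration of the vertices; another choice
  conjugates it by a permutation matrix, which affects none of the notions below.
\<close>

definition vertex_list :: "'a pair_pre_digraph \<Rightarrow> 'a list" where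
  "vertex_list G = (SOME vs. distinct vs \<and> set vs = pverts G)"

definition adj_mat :: "'a pair_pre_digraph \<Rightarrow> 'r :: {zero, one} mat" where
  "adj_mat G = mat (card (pverts G)) (card (pverts G))
    (\<lambda>(i, j). if (vertex_list G ! i, vertex_list G ! j) \<in> parcs G then 1 else 0)"

text \<open>The multiset of eigenvalues; they are all real, the adjacency matrix being symmetric.\<close>

definition adj_spectrum :: "'a pair_pre_digraph \<Rightarrow> real multiset" where
  "adj_spectrum G = proots (char_poly (adj_mat G))"

definition generalized_cospectral ::
  "'a pair_pre_digraph \<Rightarrow> 'b pair_pre_digraph \<Rightarrow> bool" where
  "generalized_cospectral G H \<longleftrightarrow>
    adj_spectrum G = adj_spectrum H \<and>
    adj_spectrum (graph_complement G) = adj_spectrum (graph_complement H)"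

definition main_eigenvalue :: "'a pair_pre_digraph \<Rightarrow> real \<Rightarrow> bool" where
  "main_eigenvalue G \<theta> \<longleftrightarrow>
    (\<exists>v. eigenvector (adj_mat G) v \<theta> \<and> v \<bullet> vec (card (pverts G)) (\<lambda>_. 1) \<noteq> 0)"

definition main_poly :: "'a pair_pre_digraph \<Rightarrow> real poly" where
  "main_poly G = (\<Prod>\<theta> | main_eigenvalue G \<theta>. [:- \<theta>, 1:])"

text \<open>
  \<open>main_poly\<close> in fact has integer coefficients, and divisibility of rational polynomials
  is the same over the rationals and over the reals, so testing \<open>f dvd main_poly G\<close> over
  the reals is no restriction.
\<close>

definition main_factor_multiplicity :: "'a pair_pre_digraph \<Rightarrow> nat" where
  "main_factor_multiplicity G =
    (let \<phi> = char_poly (adj_mat G) :: rat poly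
     in \<Sum>f | lead_coeff f = 1 \<and> irreducible f \<and> f dvd \<phi> \<and>
             map_poly real_of_rat f dvd main_poly G.
          multiplicity f \<phi>)"

end

theory Submission
  imports Defs "Jordan_Normal_Form.Schur_Decomposition"
begin

text \<open>
  The adjacency spectrum determines the power sums of the eigenvalues and hence the traces of the
  powers of the adjacency matrix \<open>A\<close>. The third such trace of the complement \<open>J - I - A\<close>
  involves, besides traces of powers of \<open>A\<close>, only the sum of the squared degrees. On the other
  hand, a closed walk \<open>a, b, c, d\<close> is degenerate if \<open>a = c\<close> or \<open>b = d\<close>, and the number
  of degenerate ones depends only on the number of edges and the sum of the squared degrees.
  So generalized cospectral graphs have equally many 4-cycles: since a tree has none, neither does
  \<open>U\<close>, and its cycle, having even length at least 3, has length at least 6.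
\<close>

section \<open>Traces of powers of symmetric matrices\<close>

definition mat_trace :: "'a :: comm_monoid_add mat \<Rightarrow> 'a" where
  "mat_trace A = (\<Sum>i<dim_row A. A $$ (i, i))"

lemma index_mult_mat_sum:
  assumes "A \<in> carrier_mat n m" "B \<in> carrier_mat m k" "i < n" "j < k"
  shows "(A * B) $$ (i, j) = (\<Sum>l<m. A $$ (i, l) * B $$ (l, j))"
  using assms by (auto simp: scalar_prod_def atLeast0LessThan)

lemma mat_trace_mult:
  assumes "A \<in> carrier_mat n m" "B \<in> carrier_mat m n"
  shows "mat_trace (A * B) = (\<Sum>i<n. \<Sum>j<m. A $$ (i, j) * B $$ (j, i))"
  unfolding mat_trace_def using assms
  by (intro sum.cong) (auto simp: index_mult_mat_sum simp del: index_mult_mat(1))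

lemma mat_trace_mult_commute:
  fixes A B :: "'a :: comm_semiring_0 mat"
  assumes "A \<in> carrier_mat n m" "B \<in> carrier_mat m n"
  shows "mat_trace (A * B) = mat_trace (B * A)"
  unfolding mat_trace_mult[OF assms] mat_trace_mult[OF assms(2,1)]
  by (subst sum.swap) (simp add: mult.commute)

text \<open>Cyclicity of the trace brings \<open>P\<close> next to \<open>Q\<close>, where the two
  cancel.\<close>

lemma similar_mat_wit_trace:
  fixes A :: "'a :: comm_ring_1 mat"
  assumes "similar_mat_wit A B P Q"
  shows "mat_trace A = mat_trace B"
proof -
  define n where "n = dim_row A"
  note w = similar_mat_witD[OF n_def assms]
  have "mat_trace A = mat_trace (P * (B * Q))"
    using w by (metis assoc_mult_mat)
  also have "\<dots> = mat_trace ((B * Q) * P)"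
    using w by (intro mat_trace_mult_commute[of _ n n]) auto
  also have "(B * Q) * P = B"
    using w by (metis assoc_mult_mat right_mult_one_mat)
  finally show ?thesis .
qed

lemma upper_triangular_mult:
  fixes A B :: "'a :: comm_semiring_1 mat"
  assumes A: "A \<in> carrier_mat n n" "upper_triangular A"
    and B: "B \<in> carrier_mat n n" "upper_triangular B"
  shows "upper_triangular (A * B)"
    and "\<And>i. i < n \<Longrightarrow> (A * B) $$ (i, i) = A $$ (i, i) * B $$ (i, i)"
proof -
  \<comment> \<open>Below the diagonal every \<open>l\<close> satisfies \<open>l < i\<close> or
    \<open>j < l\<close>; on the diagonal every \<open>l\<close> except \<open>l = i\<close>
    does.\<close>
  have z: "A $$ (i, l) * B $$ (l, j) = 0" if "i < n" "j < n" "l < n" "l < i \<or> j < l" for i j l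
    using that A B by (auto dest: upper_triangularD)
  show "upper_triangular (A * B)"
  proof (rule upper_triangularI)
    fix i j assume ij: "j < i" "i < dim_row (A * B)"
    then have "(A * B) $$ (i, j) = (\<Sum>l<n. A $$ (i, l) * B $$ (l, j))"
      using A B by (intro index_mult_mat_sum[of _ n n _ n]) auto
    also have "\<dots> = 0"
      using ij A by (intro sum.neutral ballI z) auto
    finally show "(A * B) $$ (i, j) = 0" .
  qed
  show "(A * B) $$ (i, i) = A $$ (i, i) * B $$ (i, i)" if i: "i < n" for i
  proof -
    have "(A * B) $$ (i, i) = (\<Sum>l<n. A $$ (i, l) * B $$ (l, i))"
      using A B i by (intro index_mult_mat_sum[of _ n n _ n]) auto
    also have "\<dots> = (\<Sum>l\<in>{i}. A $$ (i, l) * B $$ (l, i))"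
      using i by (intro sum.mono_neutral_right ballI z) auto
    finally show ?thesis by simp
  qed
qed

lemma upper_triangular_pow:
  fixes A :: "'a :: comm_semiring_1 mat"
  assumes A: "A \<in> carrier_mat n n" "upper_triangular A"
  shows "upper_triangular (A ^\<^sub>m k) \<and> (\<forall>i<n. (A ^\<^sub>m k) $$ (i, i) = (A $$ (i, i)) ^ k)"
proof (induction k)
  case 0
  then show ?case using A by auto
next
  case (Suc k)
  then show ?case
    using upper_triangular_mult[of "A ^\<^sub>m k" n A] A by (simp add: mult.commute)
qed

text \<open>A Schur decomposition yields a similar upper triangular matrix with diagonal
  \<open>es\<close>. Powers respect the similarity, and they act entrywise on a triangular
  diagonal.\<close>

lemma mat_trace_pow_char_poly:
  fixes A :: "'a :: conjugatable_ordered_field mat"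
  assumes A: "A \<in> carrier_mat n n" and cp: "char_poly A = (\<Prod>e\<leftarrow>es. [:- e, 1:])"
  shows "mat_trace (A ^\<^sub>m k) = (\<Sum>e\<leftarrow>es. e ^ k)"
proof -
  obtain B P Q where "schur_decomposition A es = (B, P, Q)"
    by (metis prod_cases3)
  from schur_decomposition[OF A cp this]
  have wit: "similar_mat_wit A B P Q" and B: "upper_triangular B" and es: "es = diag_mat B"
    by auto
  have Bc: "B \<in> carrier_mat n n"
    using similar_mat_witD2[OF A wit] by auto
  have "mat_trace (A ^\<^sub>m k) = mat_trace (B ^\<^sub>m k)"
    by (rule similar_mat_wit_trace[OF similar_mat_wit_pow[OF wit]])
  also have "\<dots> = (\<Sum>i<n. (B $$ (i, i)) ^ k)"
    using Bc upper_triangular_pow[OF Bc B, of k] by (auto simp: mat_trace_def)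
  also have "\<dots> = (\<Sum>e\<leftarrow>es. e ^ k)"
    using Bc by (simp add: es diag_mat_def interv_sum_list_conv_sum_set_nat atLeast0LessThan comp_def)
  finally show ?thesis .
qed

text \<open>The usual Hermitian argument: evaluating the form at an eigenvector gives
  \<open>e\<close> times a positive real, and the form is its own conjugate.\<close>

lemma symmetric_real_eigenvalue_real:
  fixes A :: "real mat" and e :: complex
  assumes A: "A \<in> carrier_mat n n"
    and sym: "\<And>i j. i < n \<Longrightarrow> j < n \<Longrightarrow> A $$ (i, j) = A $$ (j, i)"
    and ev: "eigenvalue (map_mat complex_of_real A) e"
  shows "e \<in> \<real>"
proof -
  let ?A = "map_mat complex_of_real A"
  obtain v where v: "v \<in> carrier_vec n" "v \<noteq> 0\<^sub>v n" "?A *\<^sub>v v = e \<cdot>\<^sub>v v"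
    using ev A unfolding eigenvalue_def eigenvector_def by auto
  have row: "(\<Sum>j<n. of_real (A $$ (i, j)) * v $ j) = e * v $ i" if "i < n" for i
  proof -
    have "(?A *\<^sub>v v) $ i = (\<Sum>j<n. of_real (A $$ (i, j)) * v $ j)"
      using that A v(1) by (auto simp: scalar_prod_def atLeast0LessThan intro!: sum.cong)
    moreover have "(?A *\<^sub>v v) $ i = e * v $ i"
      using v(1) that unfolding v(3) by simp
    ultimately show ?thesis by simp
  qed
  \<comment> \<open>\<open>S\<close> is the Hermitian form of \<open>A\<close> at \<open>v\<close>,
    and \<open>r\<close> is the squared norm of \<open>v\<close>.\<close>
  define S where "S = (\<Sum>i<n. \<Sum>j<n. of_real (A $$ (i, j)) * v $ j * cnj (v $ i))"
  define r where "r = (\<Sum>i<n. (cmod (v $ i))\<^sup>2)"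
  have "S = (\<Sum>i<n. e * v $ i * cnj (v $ i))"
    unfolding S_def by (intro sum.cong refl) (simp add: sum_distrib_right[symmetric] row)
  then have S: "S = e * of_real r"
    by (simp add: r_def sum_distrib_left mult.assoc complex_norm_square[symmetric])
  have "cnj S = (\<Sum>i<n. \<Sum>j<n. of_real (A $$ (j, i)) * cnj (v $ j) * v $ i)"
    unfolding S_def by (auto simp: sym intro!: sum.cong)
  also have "\<dots> = S"
    unfolding S_def by (subst sum.swap) (simp add: mult_ac)
  finally have eq: "cnj e * of_real r = e * of_real r"
    by (simp add: S)
  obtain i where "i < n" "v $ i \<noteq> 0"
    using v by (metis carrier_vecD eq_vecI index_zero_vec(1,2))
  then have "r > 0"
    unfolding r_def by (intro sum_pos2[of _ i]) auto
  with eq have "cnj e = e" by simp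
  then show ?thesis by (simp add: Reals_cnj_iff)
qed

text \<open>Over the complex numbers the characteristic polynomial splits, with real roots by the
  previous lemma. The factorization is then pulled back along the injective embedding of the
  reals.\<close>

lemma symmetric_real_char_poly_splits:
  fixes A :: "real mat"
  assumes A: "A \<in> carrier_mat n n"
    and sym: "\<And>i j. i < n \<Longrightarrow> j < n \<Longrightarrow> A $$ (i, j) = A $$ (j, i)"
  shows "\<exists>es. char_poly A = (\<Prod>e\<leftarrow>es. [:- e, 1:])"
proof -
  interpret h: map_poly_inj_idom_hom complex_of_real ..
  let ?A = "map_mat complex_of_real A"
  have cA: "?A \<in> carrier_mat n n" using A by simp
  obtain cs where cs: "char_poly ?A = (\<Prod>c\<leftarrow>cs. [:- c, 1:])"
    using char_poly_factorized[OF cA] by auto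
  have "c \<in> \<real>" if "c \<in> set cs" for c
  proof (rule symmetric_real_eigenvalue_real[OF A sym])
    show "eigenvalue ?A c"
      unfolding eigenvalue_root_char_poly[OF cA] cs using that
      by (auto simp: poly_prod_list prod_list_zero_iff)
  qed auto
  then have "map (\<lambda>c. complex_of_real (Re c)) cs = cs"
    by (intro map_idI) simp
  then have "map_poly complex_of_real (char_poly A) = (\<Prod>c\<leftarrow>cs. [:- complex_of_real (Re c), 1:])"
    unfolding of_real_hom.char_poly_hom[OF A, symmetric] cs
    by (metis (mono_tags, lifting) list.map_comp comp_apply map_eq_conv)
  also have "\<dots> = map_poly complex_of_real (\<Prod>c\<leftarrow>cs. [:- Re c, 1:])"
    by (simp add: h.hom_prod_list comp_def)
  finally have "char_poly A = (\<Prod>c\<leftarrow>cs. [:- Re c, 1:])"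
    using h.injectivity by auto
  then have "char_poly A = (\<Prod>e\<leftarrow>map Re cs. [:- e, 1:])"
    by (simp add: comp_def)
  then show ?thesis by blast
qed

text \<open>Connects traces with \<open>proots\<close>, the form in which
  \<open>adj_spectrum\<close> is defined. Splitting over the reals ensures that
  \<open>proots\<close> captures every eigenvalue with its multiplicity.\<close>

lemma mat_trace_pow_proots:
  fixes A :: "real mat"
  assumes A: "A \<in> carrier_mat n n"
    and sym: "\<And>i j. i < n \<Longrightarrow> j < n \<Longrightarrow> A $$ (i, j) = A $$ (j, i)"
  shows "mat_trace (A ^\<^sub>m k) = (\<Sum>x\<in>#proots (char_poly A). x ^ k)"
proof -
  obtain es where es: "char_poly A = (\<Prod>e\<leftarrow>es. [:- e, 1:])"
    using symmetric_real_char_poly_splits[OF A sym] by blast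
  have "proots (\<Prod>e\<leftarrow>xs. [:- e, 1:]) = mset xs" for xs :: "real list"
  proof (induction xs)
    case (Cons x xs)
    have "(\<Prod>e\<leftarrow>xs. [:- e, 1:]) \<noteq> 0" by (auto simp: prod_list_zero_iff)
    with Cons show ?case by (simp add: proots_mult del: mult_pCons_left)
  qed simp
  then have "proots (char_poly A) = mset es"
    by (simp add: es)
  then show ?thesis
    unfolding mat_trace_pow_char_poly[OF A es]
    by (simp flip: sum_mset_sum_list)
qed

section \<open>Counting closed walks\<close>

lemma mat_trace_pow_2:
  fixes A :: "'a :: semiring_1 mat"
  assumes "A \<in> carrier_mat n n"
  shows "mat_trace (A ^\<^sub>m 2) = (\<Sum>i<n. \<Sum>j<n. A $$ (i, j) * A $$ (j, i))"
proof -
  have "A ^\<^sub>m 2 = A * A" using assms by (simp add: numeral_2_eq_2)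
  then show ?thesis using mat_trace_mult[OF assms assms] by simp
qed

lemma mat_trace_pow_3:
  fixes A :: "'a :: semiring_1 mat"
  assumes A: "A \<in> carrier_mat n n"
  shows "mat_trace (A ^\<^sub>m 3) =
    (\<Sum>i<n. \<Sum>j<n. \<Sum>k<n. A $$ (i, k) * A $$ (k, j) * A $$ (j, i))"
proof -
  have "A ^\<^sub>m 3 = A * A * A" using A by (simp add: numeral_3_eq_3)
  then have "mat_trace (A ^\<^sub>m 3) = (\<Sum>i<n. \<Sum>j<n. (A * A) $$ (i, j) * A $$ (j, i))"
    using mat_trace_mult[of "A * A" n n A] A by simp
  also have "\<dots> = (\<Sum>i<n. \<Sum>j<n. \<Sum>k<n. A $$ (i, k) * A $$ (k, j) * A $$ (j, i))"
    by (intro sum.cong refl) (simp add: index_mult_mat_sum[OF A A] sum_distrib_right del: index_mult_mat(1))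
  finally show ?thesis .
qed

text \<open>Squaring the square puts the opposite vertices \<open>i\<close>, \<open>k\<close> of the
  closed walk \<open>i, j, k, l\<close> outermost, with \<open>j\<close> and \<open>l\<close> as
  midpoints of its two halves.\<close>

lemma mat_trace_pow_4:
  fixes A :: "'a :: semiring_1 mat"
  assumes A: "A \<in> carrier_mat n n"
  shows "mat_trace (A ^\<^sub>m 4) = (\<Sum>i<n. \<Sum>k<n. \<Sum>j<n. \<Sum>l<n.
    A $$ (i, j) * A $$ (j, k) * (A $$ (k, l) * A $$ (l, i)))"
proof -
  have "A ^\<^sub>m 4 = (A * A) * (A * A)"
    using A assoc_mult_mat[of "A * A" n n A n A n] by (simp add: eval_nat_numeral)
  then have "mat_trace (A ^\<^sub>m 4) = (\<Sum>i<n. \<Sum>j<n. (A * A) $$ (i, j) * (A * A) $$ (j, i))"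
    using mat_trace_mult[of "A * A" n n "A * A"] A by simp
  also have "\<dots> = (\<Sum>i<n. \<Sum>k<n. \<Sum>j<n. \<Sum>l<n.
      A $$ (i, j) * A $$ (j, k) * (A $$ (k, l) * A $$ (l, i)))"
    by (intro sum.cong refl)
      (simp add: index_mult_mat_sum[OF A A] sum_product del: index_mult_mat(1))
  finally show ?thesis .
qed

text \<open>Inclusion-exclusion over the degeneracies \<open>i = k\<close> and \<open>j = l\<close>.
  Each alone is counted by a centre with two chosen neighbours, giving the sum of squared degrees;
  both together amount to a single arc.\<close>

lemma closed_4_walks_count:
  fixes a :: "'a \<Rightarrow> 'a \<Rightarrow> real"
  assumes fin: "finite V"
    and sym: "\<And>i j. i \<in> V \<Longrightarrow> j \<in> V \<Longrightarrow> a i j = a j i"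
    and idem: "\<And>i j. i \<in> V \<Longrightarrow> j \<in> V \<Longrightarrow> a i j * a i j = a i j"
  shows "(\<Sum>i\<in>V. \<Sum>k\<in>V. \<Sum>j\<in>V. \<Sum>l\<in>V. a i j * a j k * (a k l * a l i)) =
    (\<Sum>i\<in>V. \<Sum>k\<in>V. \<Sum>j\<in>V. \<Sum>l\<in>V.
      a i j * a j k * (a k l * a l i) * of_bool (i \<noteq> k \<and> j \<noteq> l))
    + 2 * (\<Sum>i\<in>V. (\<Sum>j\<in>V. a i j)\<^sup>2) - (\<Sum>i\<in>V. \<Sum>j\<in>V. a i j)"
proof -
  let ?w = "\<lambda>i k j l. a i j * a j k * (a k l * a l i)"
  have idem': "a i j * a j i = a i j" if "i \<in> V" "j \<in> V" for i j
    using that sym idem by metis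
  \<comment> \<open>The pointwise form of inclusion-exclusion. Each conditional fixes one summation
    index by another, so the corresponding sum collapses.\<close>
  have split: "?w i k j l = ?w i k j l * of_bool (i \<noteq> k \<and> j \<noteq> l)
      + (if k = i then ?w i i j l else 0) + (if l = j then ?w i k j j else 0)
      - (if k = i then if l = j then ?w i i j j else 0 else 0)" for i k j l
    by auto
  have "(\<Sum>i\<in>V. \<Sum>k\<in>V. \<Sum>j\<in>V. \<Sum>l\<in>V. if k = i then ?w i i j l else 0) =
      (\<Sum>i\<in>V. \<Sum>k\<in>V. if k = i then \<Sum>j\<in>V. \<Sum>l\<in>V. ?w i i j l else 0)"
    by (intro sum.cong refl) auto
  also have "\<dots> = (\<Sum>i\<in>V. \<Sum>j\<in>V. \<Sum>l\<in>V. ?w i i j l)"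
    using fin by simp
  also have "\<dots> = (\<Sum>i\<in>V. \<Sum>j\<in>V. \<Sum>l\<in>V. a i j * a i l)"
  proof (intro sum.cong refl)
    fix i j l assume V: "i \<in> V" "j \<in> V" "l \<in> V"
    have "?w i i j l = (a i j * a j i) * (a i l * a l i)" by (simp add: mult_ac)
    then show "?w i i j l = a i j * a i l" using V by (simp add: idem')
  qed
  finally have 1: "(\<Sum>i\<in>V. \<Sum>k\<in>V. \<Sum>j\<in>V. \<Sum>l\<in>V. if k = i then ?w i i j l else 0) =
      (\<Sum>i\<in>V. (\<Sum>j\<in>V. a i j)\<^sup>2)"
    by (simp add: power2_eq_square sum_product)
  have "(\<Sum>i\<in>V. \<Sum>k\<in>V. \<Sum>j\<in>V. \<Sum>l\<in>V. if l = j then ?w i k j j else 0) =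
      (\<Sum>i\<in>V. \<Sum>k\<in>V. \<Sum>j\<in>V. ?w i k j j)"
    using fin by simp
  \<comment> \<open>Here the centre is \<open>j\<close>; the two exchanges of summation that follow
    move it outermost.\<close>
  also have "\<dots> = (\<Sum>i\<in>V. \<Sum>k\<in>V. \<Sum>j\<in>V. a j i * a j k)"
  proof (intro sum.cong refl)
    fix i k j assume V: "i \<in> V" "k \<in> V" "j \<in> V"
    have "?w i k j j = (a j i * a i j) * (a j k * a k j)" by (simp add: mult_ac)
    then show "?w i k j j = a j i * a j k" using V by (simp add: idem')
  qed
  also have "\<dots> = (\<Sum>i\<in>V. \<Sum>j\<in>V. \<Sum>k\<in>V. a j i * a j k)"
    by (rule sum.cong[OF refl], rule sum.swap)
  also have "\<dots> = (\<Sum>j\<in>V. \<Sum>i\<in>V. \<Sum>k\<in>V. a j i * a j k)"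
    by (rule sum.swap)
  finally have 2: "(\<Sum>i\<in>V. \<Sum>k\<in>V. \<Sum>j\<in>V. \<Sum>l\<in>V. if l = j then ?w i k j j else 0) =
      (\<Sum>i\<in>V. (\<Sum>j\<in>V. a i j)\<^sup>2)"
    by (simp add: power2_eq_square sum_product)
  have "(\<Sum>i\<in>V. \<Sum>k\<in>V. \<Sum>j\<in>V. \<Sum>l\<in>V. if k = i then if l = j then ?w i i j j else 0 else 0) =
      (\<Sum>i\<in>V. \<Sum>k\<in>V. if k = i then \<Sum>j\<in>V. \<Sum>l\<in>V. if l = j then ?w i i j j else 0 else 0)"
    by (intro sum.cong refl) auto
  also have "\<dots> = (\<Sum>i\<in>V. \<Sum>j\<in>V. ?w i i j j)"
    using fin by simp
  also have "\<dots> = (\<Sum>i\<in>V. \<Sum>j\<in>V. a i j)"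
    by (intro sum.cong refl) (simp add: idem' idem)
  finally have 3: "(\<Sum>i\<in>V. \<Sum>k\<in>V. \<Sum>j\<in>V. \<Sum>l\<in>V.
      if k = i then if l = j then ?w i i j j else 0 else 0) = (\<Sum>i\<in>V. \<Sum>j\<in>V. a i j)" .
  have "(\<Sum>i\<in>V. \<Sum>k\<in>V. \<Sum>j\<in>V. \<Sum>l\<in>V. ?w i k j l) =
      (\<Sum>i\<in>V. \<Sum>k\<in>V. \<Sum>j\<in>V. \<Sum>l\<in>V. ?w i k j l * of_bool (i \<noteq> k \<and> j \<noteq> l)
      + (if k = i then ?w i i j l else 0) + (if l = j then ?w i k j j else 0)
      - (if k = i then if l = j then ?w i i j j else 0 else 0))"
    by (intro sum.cong refl) (rule split)
  then show ?thesis
    unfolding sum.distrib sum_subtractf 1 2 3 by simp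
qed

text \<open>With \<open>x\<close> the entries of I + A, the complement has entries
  \<open>1 - x i j\<close>, and the product of three of them is expanded. A linear term sums to
  \<open>n\<close> times the total of \<open>x\<close>, a quadratic term to the sum of squared row
  sums, and the cubic term is the trace of the cube of I + A.\<close>

lemma complement_closed_3_walks_count:
  fixes a :: "'a \<Rightarrow> 'a \<Rightarrow> real"
  assumes fin: "finite V"
    and sym: "\<And>i j. i \<in> V \<Longrightarrow> j \<in> V \<Longrightarrow> a i j = a j i"
    and idem: "\<And>i j. i \<in> V \<Longrightarrow> j \<in> V \<Longrightarrow> a i j * a i j = a i j"
    and loopfree: "\<And>i. i \<in> V \<Longrightarrow> a i i = 0"
    and b: "\<And>i j. b i j = (if j = i then 0 else 1 - a i j)"
  defines "n \<equiv> real (card V)"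
  defines "s \<equiv> \<Sum>i\<in>V. \<Sum>j\<in>V. a i j"
  shows "(\<Sum>i\<in>V. \<Sum>j\<in>V. \<Sum>k\<in>V. b i k * b k j * b j i) =
    n ^ 3 - 3 * n * (n + s) + 3 * (n + 2 * s + (\<Sum>i\<in>V. (\<Sum>j\<in>V. a i j)\<^sup>2))
    - (n + 3 * s + (\<Sum>i\<in>V. \<Sum>j\<in>V. \<Sum>k\<in>V. a i k * a k j * a j i))"
proof -
  define x where "x i j = (if j = i then 1 else a i j)" for i j
  define d where "d i = (\<Sum>j\<in>V. a i j)" for i
  have s: "s = (\<Sum>i\<in>V. d i)" by (simp add: s_def d_def)
  have x_sym: "x i j = x j i" if "i \<in> V" "j \<in> V" for i j
    using sym[OF that] by (simp add: x_def)
  have row: "(\<Sum>j\<in>V. x i j) = 1 + d i" if "i \<in> V" for i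
  proof -
    have "(\<Sum>j\<in>V. x i j) = (\<Sum>j\<in>V. (if j = i then 1 else 0) + a i j)"
      using loopfree[OF that] by (intro sum.cong refl) (auto simp: x_def)
    then show ?thesis using fin that by (simp add: sum.distrib d_def)
  qed
  have col: "(\<Sum>j\<in>V. x j i) = 1 + d i" if "i \<in> V" for i
    using row[OF that] x_sym that by (metis (mono_tags, lifting) sum.cong)
  have total: "(\<Sum>i\<in>V. 1 + d i) = n + s"
    by (simp add: sum.distrib n_def s)
  have sq: "(\<Sum>i\<in>V. (1 + d i) * (1 + d i)) = n + 2 * s + (\<Sum>i\<in>V. (d i)\<^sup>2)"
    by (simp add: algebra_simps sum.distrib n_def s power2_eq_square sum_distrib_right)
  have expand: "b i k * b k j * b j i = 1 - x i k - x k j - x j i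
      + x i k * x k j + x k j * x j i + x j i * x i k - x i k * x k j * x j i" for i j k
    by (simp add: b x_def algebra_simps)
  have l1: "(\<Sum>i\<in>V. \<Sum>j\<in>V. \<Sum>k\<in>V. x i k) = n * (n + s)"
    using total by (simp add: row n_def flip: sum_distrib_left)
  have l2: "(\<Sum>i\<in>V. \<Sum>j\<in>V. \<Sum>k\<in>V. x k j) = n * (n + s)"
    using total by (simp add: col n_def)
  have l3: "(\<Sum>i\<in>V. \<Sum>j\<in>V. \<Sum>k\<in>V. x j i) = n * (n + s)"
    using total by (simp add: col n_def flip: sum_distrib_left)
  have q1: "(\<Sum>i\<in>V. \<Sum>j\<in>V. \<Sum>k\<in>V. x i k * x k j) = (\<Sum>i\<in>V. (1 + d i) * (1 + d i))"
  proof -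
    have "(\<Sum>i\<in>V. \<Sum>j\<in>V. \<Sum>k\<in>V. x i k * x k j) = (\<Sum>i\<in>V. \<Sum>k\<in>V. \<Sum>j\<in>V. x i k * x k j)"
      by (rule sum.cong[OF refl], rule sum.swap)
    also have "\<dots> = (\<Sum>k\<in>V. \<Sum>i\<in>V. \<Sum>j\<in>V. x i k * x k j)"
      by (rule sum.swap)
    also have "\<dots> = (\<Sum>k\<in>V. (\<Sum>i\<in>V. x i k) * (\<Sum>j\<in>V. x k j))"
      by (simp add: sum_product)
    finally show ?thesis by (simp add: row col)
  qed
  have q2: "(\<Sum>i\<in>V. \<Sum>j\<in>V. \<Sum>k\<in>V. x k j * x j i) = (\<Sum>i\<in>V. (1 + d i) * (1 + d i))"
  proof -
    have "(\<Sum>i\<in>V. \<Sum>j\<in>V. \<Sum>k\<in>V. x k j * x j i) = (\<Sum>j\<in>V. \<Sum>i\<in>V. \<Sum>k\<in>V. x j i * x k j)"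
      by (subst sum.swap) (simp add: mult.commute)
    also have "\<dots> = (\<Sum>j\<in>V. (\<Sum>i\<in>V. x j i) * (\<Sum>k\<in>V. x k j))"
      by (simp add: sum_product)
    finally show ?thesis by (simp add: row col)
  qed
  have q3: "(\<Sum>i\<in>V. \<Sum>j\<in>V. \<Sum>k\<in>V. x j i * x i k) = (\<Sum>i\<in>V. (1 + d i) * (1 + d i))"
  proof -
    have "(\<Sum>i\<in>V. \<Sum>j\<in>V. \<Sum>k\<in>V. x j i * x i k) = (\<Sum>i\<in>V. (\<Sum>j\<in>V. x j i) * (\<Sum>k\<in>V. x i k))"
      by (simp add: sum_product)
    then show ?thesis by (simp add: row col)
  qed
  have cube: "(\<Sum>i\<in>V. \<Sum>j\<in>V. \<Sum>k\<in>V. x i k * x k j * x j i) =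
      n + 3 * s + (\<Sum>i\<in>V. \<Sum>j\<in>V. \<Sum>k\<in>V. a i k * a k j * a j i)"
  proof -
    \<comment> \<open>Case distinction on coinciding indices: one coincidence leaves an arc
      traversed back and forth, which is a single \<open>a\<close> by symmetry and idempotence. If
      all three coincide, the \<open>a\<close> terms vanish and the last summand supplies the
      1.\<close>
    have "x i k * x k j * x j i = a i k * a k j * a j i
        + (if k = i then a i j else 0) + (if j = k then a i k else 0) + (if j = i then a i k else 0)
        + (if j = i then if k = i then 1 else 0 else 0)"
      if "i \<in> V" "j \<in> V" "k \<in> V" for i j k
      using that loopfree idem sym by (auto simp: x_def)
    then have "(\<Sum>i\<in>V. \<Sum>j\<in>V. \<Sum>k\<in>V. x i k * x k j * x j i) =
      (\<Sum>i\<in>V. \<Sum>j\<in>V. \<Sum>k\<in>V. a i k * a k j * a j i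
        + (if k = i then a i j else 0) + (if j = k then a i k else 0) + (if j = i then a i k else 0)
        + (if j = i then if k = i then 1 else 0 else 0))"
      by (intro sum.cong refl) auto
    also have "\<dots> = n + 3 * s + (\<Sum>i\<in>V. \<Sum>j\<in>V. \<Sum>k\<in>V. a i k * a k j * a j i)"
    proof -
      \<comment> \<open>The test on \<open>j\<close> is moved out of the sum over \<open>k\<close>,
        so that the sum over \<open>j\<close> can collapse.\<close>
      have "(\<Sum>i\<in>V. \<Sum>j\<in>V. \<Sum>k\<in>V. if j = i then a i k else 0) =
          (\<Sum>i\<in>V. \<Sum>j\<in>V. if j = i then \<Sum>k\<in>V. a i k else 0)"
        "(\<Sum>i\<in>V. \<Sum>j\<in>V. \<Sum>k\<in>V. if j = i then if k = i then 1 else 0 else 0) =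
          (\<Sum>i\<in>V. \<Sum>j\<in>V. if j = i then \<Sum>k\<in>V. if k = i then 1 else 0 else (0::real))"
        by (intro sum.cong refl; simp)+
      then show ?thesis
        using fin by (simp add: sum.distrib s_def n_def flip: sum_distrib_left)
    qed
    finally show ?thesis .
  qed
  have "(\<Sum>i\<in>V. \<Sum>j\<in>V. \<Sum>k\<in>V. b i k * b k j * b j i) =
    n ^ 3 - 3 * n * (n + s) + 3 * (\<Sum>i\<in>V. (1 + d i) * (1 + d i))
    - (n + 3 * s + (\<Sum>i\<in>V. \<Sum>j\<in>V. \<Sum>k\<in>V. a i k * a k j * a j i))"
    unfolding expand sum.distrib sum_subtractf l1 l2 l3 q1 q2 q3 cube
    by (simp add: n_def power3_eq_cube)
  then show ?thesis
    unfolding sq by (simp add: d_def)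
qed

section \<open>Cycles\<close>

lemma pawalk_verts_conv: "pcas u p v \<Longrightarrow> pawalk_verts u p = u # map snd p"
  by (induction p arbitrary: u) auto

text \<open>For a closed walk this says that the list of arc heads is a rotation of the list of arc
  tails.\<close>

lemma pcas_verts: "pcas u p v \<Longrightarrow> u # map snd p = map fst p @ [v]"
  by (induction p arbitrary: u) auto

text \<open>Reduces the library notion of a cycle to conditions on the arc list, on which the later
  arguments work.\<close>

lemma graph_cycles_altdef:
  "graph_cycles G = {(\<lambda>(u, v). {u, v}) ` set p | p u.
    u \<in> pverts G \<and> set p \<subseteq> parcs G \<and> pcas u p u \<and> distinct (map snd p) \<and> 3 \<le> length p}"
proof -
  have "pre_digraph.cycle (with_proj G) p \<longleftrightarrow>
    (\<exists>u. u \<in> pverts G \<and> set p \<subseteq> parcs G \<and> pcas u p u \<and> distinct (map snd p)) \<and> p \<noteq> []" for p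
    by (auto simp: pre_digraph.cycle_def pre_digraph.awalk_def cas_with_proj_eq
        awalk_verts_with_proj_eq pawalk_verts_conv)
  then show ?thesis
    unfolding graph_cycles_def by (intro Collect_cong) (metis list.size(3) not_numeral_le_zero)
qed

text \<open>Forgetting directions identifies two arcs only if they are mutually reverse, and a cycle
  of length at least 3 cannot contain both an arc and its reverse.\<close>

lemma card_cycle_edges:
  assumes cas: "pcas u p u" and dist: "distinct (map snd p)" and len: "3 \<le> length p"
  shows "card ((\<lambda>(u, v). {u, v}) ` set p) = length p"
proof -
  define n where "n = length p"
  \<comment> \<open>Since the walk is closed, its endpoint \<open>u\<close> cancels on both
    sides.\<close>
  have "mset (map fst p) = mset (map snd p)"
    using arg_cong[OF pcas_verts[OF cas], of mset] by simp
  then have dist': "distinct (map fst p)"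
    using dist by (metis mset_eq_imp_distinct_iff)
  have "fst (p ! 0) = u"
    using arg_cong[OF pcas_verts[OF cas], of hd] len by (cases p) auto
  moreover have "snd (p ! i) = (map fst p @ [u]) ! Suc i" if "i < n" for i
    using arg_cong[OF pcas_verts[OF cas], of "\<lambda>vs. vs ! Suc i"] that by (simp add: n_def)
  \<comment> \<open>Indices are cyclic: the arc after the last one is the arc at 0.\<close>
  ultimately have succ: "snd (p ! i) = fst (p ! (if Suc i = n then 0 else Suc i))" if "i < n" for i
    using that by (auto simp: n_def nth_append)
  have no_back: False if xy: "(x, y) \<in> set p" and yx: "(y, x) \<in> set p" for x y
  proof -
    define nxt where "nxt i = (if Suc i = n then 0 else Suc i)" for i
    obtain i where i: "i < n" "p ! i = (x, y)"
      using xy by (auto simp: in_set_conv_nth n_def)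
    obtain j where j: "j < n" "p ! j = (y, x)"
      using yx by (auto simp: in_set_conv_nth n_def)
    have inj: "k = l" if "fst (p ! k) = fst (p ! l)" "k < n" "l < n" for k l
      using nth_eq_iff_index_eq[OF dist', of k l] that by (simp add: n_def)
    have "fst (p ! j) = fst (p ! nxt i)" "fst (p ! i) = fst (p ! nxt j)"
      unfolding nxt_def succ[OF i(1), symmetric] succ[OF j(1), symmetric] i(2) j(2) by simp_all
    moreover have "nxt i < n" "nxt j < n"
      using i(1) j(1) by (auto simp: nxt_def)
    ultimately have "j = nxt i" "i = nxt j"
      using inj i(1) j(1) by blast+
    \<comment> \<open>Two cyclic steps lead from \<open>i\<close> back to \<open>i\<close>, which is
      impossible for \<open>n\<close> at least 3.\<close>
    then show False using len i(1) by (auto simp: n_def nxt_def split: if_splits)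
  qed
  have "inj_on (\<lambda>(u, v). {u, v}) (set p)"
    by (auto simp: inj_on_def doubleton_eq_iff dest: no_back)
  then have "card ((\<lambda>(u, v). {u, v}) ` set p) = card (set p)"
    by (rule card_image)
  also have "\<dots> = length p"
    using dist by (simp add: distinct_card distinct_map)
  finally show ?thesis .
qed

lemma graph_cycle_card_ge_3: "C \<in> graph_cycles G \<Longrightarrow> 3 \<le> card C"
  by (auto simp: graph_cycles_altdef card_cycle_edges)

text \<open>Every arc switches sides.\<close>

lemma bipartite_walk_parity:
  assumes "A \<inter> B = {}" "set p \<subseteq> A \<times> B \<union> B \<times> A" "pcas u p v"
  shows "even (length p) \<longleftrightarrow> (u \<in> A \<longleftrightarrow> v \<in> A)"
  using assms(2,3)
proof (induction p arbitrary: u)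
  case (Cons e p)
  then have "even (length p) \<longleftrightarrow> (snd e \<in> A \<longleftrightarrow> v \<in> A)" and "fst e = u" by auto
  with Cons.prems assms(1) show ?case by auto
qed simp

lemma bipartite_cycle_even:
  assumes "bipartite G" "C \<in> graph_cycles G"
  shows "even (card C)"
proof -
  obtain A B where AB: "A \<inter> B = {}" "parcs G \<subseteq> A \<times> B \<union> B \<times> A"
    using assms(1) unfolding bipartite_def by blast
  obtain p u where p: "C = (\<lambda>(u, v). {u, v}) ` set p" "set p \<subseteq> parcs G" "pcas u p u"
      "distinct (map snd p)" "3 \<le> length p"
    using assms(2) unfolding graph_cycles_altdef by blast
  have "even (length p)"
    using bipartite_walk_parity[OF AB(1) _ p(3)] p(2) AB(2) by auto
  then show ?thesis
    using p by (simp add: card_cycle_edges)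
qed

text \<open>Consecutive vertices differ because there are no loops, so \<open>a \<noteq> c\<close>
  and \<open>b \<noteq> d\<close> already make all four distinct. The right-hand side refers to arcs
  only and is monotone in them.\<close>

lemma (in pair_graph) ex_4_cycle_iff:
  "(\<exists>C\<in>graph_cycles G. card C = 4) \<longleftrightarrow>
    (\<exists>a b c d. (a, b) \<in> parcs G \<and> (b, c) \<in> parcs G \<and> (c, d) \<in> parcs G \<and> (d, a) \<in> parcs G
      \<and> a \<noteq> c \<and> b \<noteq> d)"
  (is "_ \<longleftrightarrow> ?walk")
proof
  assume "\<exists>C\<in>graph_cycles G. card C = 4"
  then obtain p u where p: "set p \<subseteq> parcs G" "pcas u p u" "distinct (map snd p)" "length p = 4"
    unfolding graph_cycles_altdef by (force simp: card_cycle_edges)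
  then obtain e1 e2 e3 e4 where "p = [e1, e2, e3, e4]"
    by (auto simp: eval_nat_numeral length_Suc_conv)
  with p show ?walk by (cases e1; cases e2; cases e3; cases e4) auto
next
  assume ?walk
  then obtain a b c d where w: "(a, b) \<in> parcs G" "(b, c) \<in> parcs G" "(c, d) \<in> parcs G"
    "(d, a) \<in> parcs G" "a \<noteq> c" "b \<noteq> d" by blast
  define p where "p = [(a, b), (b, c), (c, d), (d, a)]"
  have p: "a \<in> pverts G" "set p \<subseteq> parcs G" "pcas a p a" "distinct (map snd p)" "length p = 4"
    using w in_arcsD1 pair_no_loops by (fastforce simp: p_def)+
  then have "(\<lambda>(u, v). {u, v}) ` set p \<in> graph_cycles G"
    unfolding graph_cycles_altdef by force
  moreover have "card ((\<lambda>(u, v). {u, v}) ` set p) = 4"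
    using card_cycle_edges[OF p(3,4)] p(5) by simp
  ultimately show "\<exists>C\<in>graph_cycles G. card C = 4" by blast
qed

section \<open>Spectral count of 4-cycles\<close>

text \<open>A 4-cycle gives rise to eight of these non-degenerate walks, one for each start and direction.\<close>

definition proper_closed_4_walks :: "'a pair_pre_digraph \<Rightarrow> real" where
  "proper_closed_4_walks G = (let n = card (pverts G); a = (\<lambda>i j. adj_mat G $$ (i, j)) in
    \<Sum>i<n. \<Sum>k<n. \<Sum>j<n. \<Sum>l<n.
      a i j * a j k * (a k l * a l i) * of_bool (i \<noteq> k \<and> j \<noteq> l))"

lemma adj_mat_carrier: "adj_mat G \<in> carrier_mat (card (pverts G)) (card (pverts G))"
  by (simp add: adj_mat_def)

lemma adj_mat_index:
  assumes "i < card (pverts G)" "j < card (pverts G)"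
  shows "adj_mat G $$ (i, j) = of_bool ((vertex_list G ! i, vertex_list G ! j) \<in> parcs G)"
  using assms by (simp add: adj_mat_def)

lemma vertex_list:
  assumes "finite (pverts G)"
  shows "distinct (vertex_list G)" "set (vertex_list G) = pverts G"
    "length (vertex_list G) = card (pverts G)"
proof -
  have "\<exists>vs. distinct vs \<and> set vs = pverts G"
    using finite_distinct_list[OF assms] by blast
  then have "distinct (vertex_list G) \<and> set (vertex_list G) = pverts G"
    unfolding vertex_list_def by (rule someI_ex)
  then show "distinct (vertex_list G)" "set (vertex_list G) = pverts G"
    "length (vertex_list G) = card (pverts G)"
    by (auto simp flip: distinct_card)
qed

context pair_graph
begin

lemma arcs_sym: "(u, v) \<in> parcs G \<longleftrightarrow> (v, u) \<in> parcs G"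
  using pair_sym_arcs unfolding symmetric_def sym_def by auto

lemma adj_mat_sym:
  assumes "i < card (pverts G)" "j < card (pverts G)"
  shows "(adj_mat G :: 'r :: {zero_neq_one, semiring_1} mat) $$ (i, j) = adj_mat G $$ (j, i)"
  using assms arcs_sym by (simp add: adj_mat_index)

lemma adj_mat_complement:
  assumes "i < card (pverts G)" "j < card (pverts G)"
  shows "(adj_mat (graph_complement G) :: real mat) $$ (i, j) =
    (if j = i then 0 else 1 - adj_mat G $$ (i, j))"
proof -
  note vl = vertex_list[OF pair_finite_verts]
  \<comment> \<open>The choice of enumeration depends on the vertex set only, so both matrices use
    the same one.\<close>
  have "vertex_list (graph_complement G) = vertex_list G"
    by (simp add: vertex_list_def graph_complement_def)
  moreover have "vertex_list G ! i = vertex_list G ! j \<longleftrightarrow> j = i"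
    using assms vl by (metis nth_eq_iff_index_eq)
  moreover have "vertex_list G ! i \<in> pverts G" "vertex_list G ! j \<in> pverts G"
    using assms vl by (metis nth_mem)+
  ultimately show ?thesis
    using assms by (simp add: adj_mat_def graph_complement_def)
qed

lemma adj_spectrum_trace:
  "mat_trace (adj_mat G ^\<^sub>m k :: real mat) = (\<Sum>x\<in>#adj_spectrum G. x ^ k)"
  unfolding adj_spectrum_def
  by (rule mat_trace_pow_proots[OF adj_mat_carrier adj_mat_sym])

lemma complement_adj_spectrum_trace:
  "mat_trace (adj_mat (graph_complement G) ^\<^sub>m k :: real mat) =
    (\<Sum>x\<in>#adj_spectrum (graph_complement G). x ^ k)"
  unfolding adj_spectrum_def
proof (rule mat_trace_pow_proots)
  show "adj_mat (graph_complement G) \<in> carrier_mat (card (pverts G)) (card (pverts G))"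
    by (simp add: adj_mat_def graph_complement_def)
qed (auto simp: adj_mat_complement adj_mat_sym)

text \<open>The sum of squared degrees enters \<open>t 4\<close> with coefficient 2 and
  \<open>t' 3\<close> with coefficient 3; it cancels in \<open>3 * t 4 - 2 * t' 3\<close>. All other
  terms are power sums: \<open>t 0\<close> is the number of vertices and \<open>t 2\<close> the
  number of arcs.\<close>

lemma proper_closed_4_walks_spectral:
  fixes t t' :: "nat \<Rightarrow> real"
  defines "t \<equiv> \<lambda>k. \<Sum>x\<in>#adj_spectrum G. x ^ k"
  defines "t' \<equiv> \<lambda>k. \<Sum>x\<in>#adj_spectrum (graph_complement G). x ^ k"
  shows "3 * proper_closed_4_walks G = 3 * t 4 + 3 * t 2 - 2 * t' 3 + 2 * t 0 ^ 3 - 6 * t 0 * (t 0 + t 2)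
    + 6 * (t 0 + 2 * t 2) - 2 * (t 0 + 3 * t 2 + t 3)"
proof -
  define n where "n = card (pverts G)"
  define A where "A = (adj_mat G :: real mat)"
  define B where "B = (adj_mat (graph_complement G) :: real mat)"
  define a where "a i j = A $$ (i, j)" for i j
  define b where "b i j = (if j = i then 0 else 1 - a i j)" for i j
  have Ac: "A \<in> carrier_mat n n" by (simp add: A_def n_def adj_mat_def)
  have Bc: "B \<in> carrier_mat n n" by (simp add: B_def n_def adj_mat_def graph_complement_def)
  have B: "B $$ (i, j) = b i j" if "i < n" "j < n" for i j
    using that by (simp add: B_def b_def a_def A_def n_def adj_mat_complement)
  have sym: "a i j = a j i" if "i \<in> {..<n}" "j \<in> {..<n}" for i j
    using that by (simp add: a_def A_def n_def adj_mat_sym)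
  have idem: "a i j * a i j = a i j" if "i \<in> {..<n}" "j \<in> {..<n}" for i j
    using that by (simp add: a_def A_def n_def adj_mat_index)
  have loopfree: "a i i = 0" if "i \<in> {..<n}" for i
    using that by (auto simp: a_def A_def n_def adj_mat_index dest: pair_no_loops)
  have idem': "a i j * a j i = a i j" if "i \<in> {..<n}" "j \<in> {..<n}" for i j
    using sym idem that by metis
  have t0: "t 0 = n"
    using adj_spectrum_trace[of 0] Ac by (simp add: t_def A_def mat_trace_def)
  have "t 2 = (\<Sum>i<n. \<Sum>j<n. a i j * a j i)"
    using adj_spectrum_trace[of 2] mat_trace_pow_2[OF Ac] by (simp add: t_def A_def a_def)
  also have "\<dots> = (\<Sum>i<n. \<Sum>j<n. a i j)"
    by (intro sum.cong refl idem')
  finally have t2: "t 2 = (\<Sum>i<n. \<Sum>j<n. a i j)" .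
  have t3: "t 3 = (\<Sum>i<n. \<Sum>j<n. \<Sum>k<n. a i k * a k j * a j i)"
    using adj_spectrum_trace[of 3] mat_trace_pow_3[OF Ac] by (simp add: t_def A_def a_def)
  have t4: "t 4 = (\<Sum>i<n. \<Sum>k<n. \<Sum>j<n. \<Sum>l<n. a i j * a j k * (a k l * a l i))"
    using adj_spectrum_trace[of 4] mat_trace_pow_4[OF Ac] by (simp add: t_def A_def a_def)
  have t3': "t' 3 = (\<Sum>i<n. \<Sum>j<n. \<Sum>k<n. b i k * b k j * b j i)"
    using complement_adj_spectrum_trace[of 3] mat_trace_pow_3[OF Bc]
    by (simp add: t'_def B_def[symmetric] B)
  have c: "proper_closed_4_walks G = (\<Sum>i<n. \<Sum>k<n. \<Sum>j<n. \<Sum>l<n.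
      a i j * a j k * (a k l * a l i) * of_bool (i \<noteq> k \<and> j \<noteq> l))"
    by (simp only: proper_closed_4_walks_def Let_def n_def a_def A_def)
  \<comment> \<open>The sum of squared degrees, which is eliminated between the next two
    equations.\<close>
  define D where "D = (\<Sum>i<n. (\<Sum>j<n. a i j)\<^sup>2)"
  have e4: "t 4 = proper_closed_4_walks G + 2 * D - t 2"
    unfolding t4 c t2 D_def by (rule closed_4_walks_count[OF _ sym idem]) auto
  have "t' 3 = t 0 ^ 3 - 3 * t 0 * (t 0 + t 2) + 3 * (t 0 + 2 * t 2 + D) - (t 0 + 3 * t 2 + t 3)"
    using complement_closed_3_walks_count[OF finite_lessThan sym idem loopfree b_def]
    unfolding t3' t0 t2 t3 D_def card_lessThan .
  with e4 show ?thesis by (simp add: algebra_simps)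
qed

text \<open>A sum of nonnegative terms vanishes only if every term does; the enumeration
  \<open>f\<close> then translates index walks into vertex walks and back.\<close>

lemma proper_closed_4_walks_eq_0_iff: "proper_closed_4_walks G = 0 \<longleftrightarrow> \<not> (\<exists>C\<in>graph_cycles G. card C = 4)"
proof -
  note vl = vertex_list[OF pair_finite_verts]
  define n where "n = card (pverts G)"
  define f where "f i = vertex_list G ! i" for i
  have f_inj: "f i = f j \<longleftrightarrow> i = j" if "i < n" "j < n" for i j
    using that vl by (simp add: f_def n_def nth_eq_iff_index_eq)
  have f_ex: "\<exists>i<n. f i = v" if "v \<in> pverts G" for v
    using that vl by (metis f_def in_set_conv_nth n_def)
  define N where "N i k j l \<longleftrightarrow> (f i, f j) \<in> parcs G \<and> (f j, f k) \<in> parcs G \<and> (f k, f l) \<in> parcs G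
    \<and> (f l, f i) \<in> parcs G \<and> i \<noteq> k \<and> j \<noteq> l" for i k j l
  have "proper_closed_4_walks G = (\<Sum>i<n. \<Sum>k<n. \<Sum>j<n. \<Sum>l<n. of_bool (N i k j l))"
    unfolding proper_closed_4_walks_def Let_def n_def[symmetric]
    by (intro sum.cong refl) (auto simp: adj_mat_index n_def N_def f_def)
  then have "proper_closed_4_walks G = 0 \<longleftrightarrow> (\<forall>i<n. \<forall>k<n. \<forall>j<n. \<forall>l<n. \<not> N i k j l)"
    by (simp add: sum_nonneg_eq_0_iff sum_nonneg del: sum_of_bool_eq) blast
  also have "\<dots> \<longleftrightarrow> \<not> (\<exists>C\<in>graph_cycles G. card C = 4)"
  proof -
    have "(\<exists>i<n. \<exists>k<n. \<exists>j<n. \<exists>l<n. N i k j l) \<longleftrightarrow>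
      (\<exists>a b c d. (a, b) \<in> parcs G \<and> (b, c) \<in> parcs G \<and> (c, d) \<in> parcs G \<and> (d, a) \<in> parcs G
        \<and> a \<noteq> c \<and> b \<noteq> d)" (is "?L \<longleftrightarrow> ?R")
    proof
      assume ?L
      then show ?R unfolding N_def using f_inj by metis
    next
      assume ?R
      then obtain a b c d where w: "(a, b) \<in> parcs G" "(b, c) \<in> parcs G" "(c, d) \<in> parcs G"
        "(d, a) \<in> parcs G" "a \<noteq> c" "b \<noteq> d" by blast
      then obtain i j k l where "i < n" "j < n" "k < n" "l < n" "f i = a" "f j = b" "f k = c" "f l = d"
        using f_ex in_arcsD1 by metis
      with w show ?L unfolding N_def by blast
    qed
    then show ?thesis unfolding ex_4_cycle_iff by blast
  qed
  finally show ?thesis .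
qed

end

text \<open>The spectral formula depends on the graph only through the two spectra.\<close>

lemma generalized_cospectral_proper_closed_4_walks:
  assumes "pair_graph G" "pair_graph H" "generalized_cospectral G H"
  shows "proper_closed_4_walks G = proper_closed_4_walks H"
  using pair_graph.proper_closed_4_walks_spectral[OF assms(1)]
    pair_graph.proper_closed_4_walks_spectral[OF assms(2)] assms(3)
  unfolding generalized_cospectral_def by simp

theorem corollary4p6:
  fixes T :: "'a pair_pre_digraph" and H R U :: "'b pair_pre_digraph"
  assumes "is_tree T"
    and "main_factor_multiplicity T = 2"
    and "pair_graph H" and "\<not> Digraph_Component.connected (with_proj H)"
    and "generalized_cospectral H T"
    and "disjoint_union H R U"
    and "is_tree R"
    and "unicyclic U" and "bipartite U"
  shows "\<exists>C l. graph_cycles U = {C} \<and> card C = 2 * l \<and> 6 \<le> card C \<and> 3 \<le> l"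
proof -
  have T: "pair_graph T" "graph_cycles T = {}"
    using assms(1) by (auto simp: is_tree_def)
  have U: "pair_graph U"
    using assms(8) by (simp add: unicyclic_def)
  obtain C where C: "graph_cycles U = {C}"
    using assms(8) unfolding unicyclic_def by blast
  obtain l where l: "card C = 2 * l"
    using bipartite_cycle_even[OF assms(9)] C by (auto elim: evenE)
  have "proper_closed_4_walks H = 0"
    using generalized_cospectral_proper_closed_4_walks[OF assms(3) T(1) assms(5)]
      pair_graph.proper_closed_4_walks_eq_0_iff[OF T(1)] T(2) by simp
  then have "\<not> (\<exists>C\<in>graph_cycles H. card C = 4)"
    using pair_graph.proper_closed_4_walks_eq_0_iff[OF assms(3)] by simp
  moreover have "parcs U \<subseteq> parcs H"
    using assms(6) by (auto simp: disjoint_union_def)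
  \<comment> \<open>A 4-cycle of \<open>U\<close>, read as a closed walk of arcs, would also be one
    of \<open>H\<close>.\<close>
  ultimately have "\<not> (\<exists>C\<in>graph_cycles U. card C = 4)"
    unfolding pair_graph.ex_4_cycle_iff[OF assms(3)] pair_graph.ex_4_cycle_iff[OF U] by blast
  with C have "card C \<noteq> 4" by simp
  moreover have "3 \<le> card C"
    using graph_cycle_card_ge_3[of C U] C by simp
  \<comment> \<open>An even number that is at least 3 and different from 4 is at least 6.\<close>
  ultimately have "3 \<le> l" using l by presburger
  with C l show ?thesis by auto
qed

end
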